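(* Let $E$ be a Polish space with Borel $\sigma$-algebra $\mathscr{E}$, let $\psi:E\to[1,\infty)$ be continuous, and let $\mathbb{P}$ be a probability measure on $\Omega=E^{\mathbb{N}}$, with coordinate projections $\xi=(\xi_1,\xi_2,\dots)$, empirical measures $m_n=\frac1n\sum_{i=1}^n\delta_{\xi_i}$, and canonical random measure $\upsilon$ (a regular version of $\mathbb{P}[\xi_1\in\cdot\,\vert\,\mathscr{I}]$ given the shift-invariant $\sigma$-algebra $\mathscr{I}$). Let $T$ be a Polish space. If $\xi$ is stationary with $\mathscr{L}(\xi_1)\in\mathfrak{M}_1^\psi(E)$, and $\tau:\mathfrak{M}_1^\psi(E)\to T$ is $\psi$-continuous (continuous for the $\psi$-weak topology), then the sequence of estimators $\tau_n:=\tau(m_n)$ is strongly consistent for $\tau(\upsilon)$, i.e. $\mathbb{P}$-almost surely $\tau(m_n)\to\tau(\upsilon)$ in $T$ as $n\to+\infty$.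
   Context: $\mathfrak{M}_1(E)$ is the set of Borel probability measures on $E$, and $\mu f:=\int_E f\,d\mu$. For the continuous gauge function $\psi\ge 1$: $\mathfrak{M}_1^\psi(E):=\{\mu\in\mathfrak{M}_1(E):\mu\psi<+\infty\}$ and $\mathfrak{C}_\psi(E):=\{f:E\to\mathbb{R}\text{ continuous}:\ \|f/\psi\|_\infty<\infty\}$. The $\psi$-weak topology is the coarsest topology on $\mathfrak{M}_1^\psi(E)$ making all maps $\mu\mapsto\mu f$, $f\in\mathfrak{C}_\psi(E)$, continuous. $\Omega=E^{\mathbb{N}}$, $\xi_n(\omega)=\omega_n$, $\mathscr{F}$ is the product $\sigma$-algebra $\mathscr{E}^{\mathbb{N}}$ generated by the $\xi_n$, and $(\Omega,\mathscr{F},\mathbb{P})$ is taken to be complete (i.e. completed with respect to $\mathbb{P}$). $\mathscr{L}(\xi_1)=\mathbb{P}\circ\xi_1^{-1}$. $\Sigma(x_1,x_2,\dots)=(x_2,x_3,\dots)$ is the shift on $E^{\mathbb{N}}$. $\xi$ is stationary if $\xi$ and $\Sigma\xi$ have the same law on $(E^{\mathbb{N}},\mathscr{E}^{\mathbb{N}})$. The shift-invariant $\sigma$-algebra is $\mathscr{I}=\{I\in\mathscr{E}^{\mathbb{N}}:\Sigma^{-1}(I)=I\}$. The canonical random measure $\upsilon$ is an ($\mathbb{P}$-essentially unique) $\mathscr{I}$-measurable probability kernel $(\omega,B)\mapsto\upsilon(\omega,B)$ that is a regular version of $\mathbb{P}[\xi_1\in\cdot\,\vert\,\mathscr{I}]$.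 When $\mathscr{L}(\xi_1)\in\mathfrak{M}_1^\psi(E)$, one has $\upsilon\in\mathfrak{M}_1^\psi(E)$ $\mathbb{P}$-almost surely, so $\tau(\upsilon)$ is $\mathbb{P}$-almost surely defined. *)

theory Defs
  imports "HOL-Probability.Probability"
begin

text \<open>
  A Polish space is a type of class \<open>polish_space\<close>; its Borel probability measures are the
  elements of \<open>space (prob_algebra borel)\<close>.  Sequences are indexed from 0, so that the
  projection usually written \<open>\<xi>\<^sub>i\<close> (with \<open>i \<ge> 1\<close>) is \<open>\<lambda>\<omega>. \<omega> (i - 1)\<close>.
\<close>


subsection \<open>The weak topology with gauge function\<close>

definition prob_measures_gauge :: "('e::polish_space \<Rightarrow> real) \<Rightarrow> 'e measure set" where
  "prob_measures_gauge \<psi> =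
     {\<mu> \<in> space (prob_algebra borel). (\<integral>\<^sup>+ x. ennreal (\<psi> x) \<partial>\<mu>) < \<infinity>}"

definition gauge_continuous :: "('e::polish_space \<Rightarrow> real) \<Rightarrow> ('e \<Rightarrow> real) set" where
  "gauge_continuous \<psi> =
     {f. continuous_on UNIV f \<and> bounded (range (\<lambda>x. f x / \<psi> x))}"

definition psi_weak_topology :: "('e::polish_space \<Rightarrow> real) \<Rightarrow> 'e measure topology" where
  "psi_weak_topology \<psi> = topology_generated_by
     {{\<mu> \<in> prob_measures_gauge \<psi>. (\<integral>x. f x \<partial>\<mu>) \<in> U} | f U.
        f \<in> gauge_continuous \<psi> \<and> open U}"

text \<open>
  For a gauge \<open>\<psi> \<ge> 1\<close> every \<open>f \<in> gauge_continuous \<psi>\<close> is integrable, so the Bochner integrals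
  above are not default values, and \<open>psi_weak_topology \<psi>\<close> is the coarsest topology making
  all \<open>\<mu> \<mapsto> \<mu> f\<close> continuous.
\<close>

lemma integrable_gauge_continuous:
  fixes \<psi> :: "'e::polish_space \<Rightarrow> real"
  assumes \<psi>: "continuous_on UNIV \<psi>" "\<And>x. 1 \<le> \<psi> x"
    and \<mu>: "\<mu> \<in> prob_measures_gauge \<psi>" and f: "f \<in> gauge_continuous \<psi>"
  shows "integrable \<mu> f"
proof -
  have sets: "sets \<mu> = sets borel"
    using \<mu> by (simp add: prob_measures_gauge_def space_prob_algebra)
  have [measurable]: "\<psi> \<in> borel_measurable \<mu>" "f \<in> borel_measurable \<mu>"
    using \<psi>(1) f measurable_cong_sets[OF sets refl]
    by (auto simp: gauge_continuous_def intro: borel_measurable_continuous_onI)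
  obtain C where C: "\<And>x. \<bar>f x / \<psi> x\<bar> \<le> C"
    using f by (auto simp: gauge_continuous_def bounded_iff)
  have pos: "0 < \<psi> x" for x
    using \<psi>(2)[of x] by linarith
  have "integrable \<mu> \<psi>"
    using \<mu> by (intro integrableI_nonneg) (simp_all add: prob_measures_gauge_def pos less_imp_le)
  then have "integrable \<mu> (\<lambda>x. C * \<psi> x)"
    by simp
  then show ?thesis
  proof (rule Bochner_Integration.integrable_bound)
    show "AE x in \<mu>. norm (f x) \<le> norm (C * \<psi> x)"
    proof (rule AE_I2)
      fix x
      have "\<bar>f x\<bar> \<le> C * \<psi> x"
        using C[of x] pos[of x] by (simp add: abs_mult divide_le_eq)
      then show "norm (f x) \<le> norm (C * \<psi> x)"
        by simp
    qed
  qed simp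
qed

lemma topspace_psi_weak_topology [simp]:
  "topspace (psi_weak_topology \<psi>) = prob_measures_gauge \<psi>"
proof -
  have "(\<lambda>_. 0) \<in> gauge_continuous \<psi>"
    by (simp add: gauge_continuous_def image_constant_conv)
  then have "prob_measures_gauge \<psi> \<in>
      {{\<mu> \<in> prob_measures_gauge \<psi>. (\<integral>x. f x \<partial>\<mu>) \<in> U} | f U. f \<in> gauge_continuous \<psi> \<and> open U}"
    by (intro CollectI exI[of _ "\<lambda>_. 0"] exI[of _ UNIV]) simp
  then show ?thesis
    unfolding psi_weak_topology_def topology_generated_by_topspace
    by (intro equalityI Union_least Union_upper) (elim CollectE exE conjE, simp)
qed

lemma continuous_map_psi_weak_topology_integral:
  assumes "f \<in> gauge_continuous \<psi>"
  shows "continuous_map (psi_weak_topology \<psi>) euclideanreal (\<lambda>\<mu>. \<integral>x. f x \<partial>\<mu>)"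
  unfolding continuous_map topspace_psi_weak_topology
proof (intro conjI allI impI)
  fix U :: "real set"
  assume "openin euclideanreal U"
  then have "open U"
    by simp
  with assms show "openin (psi_weak_topology \<psi>) {\<mu> \<in> prob_measures_gauge \<psi>. (\<integral>x. f x \<partial>\<mu>) \<in> U}"
    unfolding psi_weak_topology_def by (intro topology_generated_by_Basis) blast
qed simp

lemma psi_weak_topology_coarsest:
  assumes "topspace X = prob_measures_gauge \<psi>"
    and "\<And>f. f \<in> gauge_continuous \<psi> \<Longrightarrow> continuous_map X euclideanreal (\<lambda>\<mu>. \<integral>x. f x \<partial>\<mu>)"
    and "openin (psi_weak_topology \<psi>) V"
  shows "openin X V"
proof -
  have "generate_topology_on {{\<mu> \<in> prob_measures_gauge \<psi>. (\<integral>x. f x \<partial>\<mu>) \<in> U} | f U.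
        f \<in> gauge_continuous \<psi> \<and> open U} V"
    using assms(3) by (simp add: psi_weak_topology_def openin_topology_generated_by_iff)
  then show ?thesis
  proof induction
    case (Basis s)
    then obtain f U where s: "s = {\<mu> \<in> topspace X. (\<integral>x. f x \<partial>\<mu>) \<in> U}"
      and "f \<in> gauge_continuous \<psi>" "open U"
      using assms(1) by auto
    then show ?case
      using assms(2) unfolding s by (intro openin_continuous_map_preimage) auto
  qed auto
qed


subsection \<open>Stationary sequences and the canonical random measure\<close>

abbreviation seq_space :: "(nat \<Rightarrow> 'e::polish_space) measure" where
  "seq_space \<equiv> \<Pi>\<^sub>M i\<in>UNIV. borel"

definition shift_seq :: "(nat \<Rightarrow> 'e) \<Rightarrow> nat \<Rightarrow> 'e" where
  "shift_seq \<omega> = (\<lambda>n. \<omega> (Suc n))"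

definition stationary :: "(nat \<Rightarrow> 'e::polish_space) measure \<Rightarrow> bool" where
  "stationary P \<longleftrightarrow> distr P seq_space shift_seq = distr P seq_space (\<lambda>\<omega>. \<omega>)"

definition shift_invariant :: "(nat \<Rightarrow> 'e::polish_space) measure" where
  "shift_invariant = sigma UNIV {I \<in> sets seq_space. shift_seq -` I = I}"

lemma sets_shift_invariant:
  "sets shift_invariant =
     {I \<in> sets (seq_space :: (nat \<Rightarrow> 'e::polish_space) measure). shift_seq -` I = I}"
proof -
  let ?S = "{I \<in> sets (seq_space :: (nat \<Rightarrow> 'e) measure). shift_seq -` I = I}"
  have sp: "space (seq_space :: (nat \<Rightarrow> 'e) measure) = UNIV"
    by (simp add: space_PiM)
  have "sigma_algebra UNIV ?S"
    unfolding sigma_algebra_iff2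
  proof (intro conjI ballI allI impI)
    fix A assume "A \<in> ?S"
    then show "UNIV - A \<in> ?S"
      using sets.compl_sets[of A seq_space] by (auto simp: sp)
  next
    fix A :: "nat \<Rightarrow> (nat \<Rightarrow> 'e) set" assume "range A \<subseteq> ?S"
    then show "\<Union> (range A) \<in> ?S"
      by (auto simp: vimage_UN)
  qed simp_all
  then show ?thesis
    unfolding shift_invariant_def by (rule sigma_algebra.sets_measure_of_eq)
qed

lemma subalgebra_shift_invariant:
  assumes "sets P = sets seq_space"
  shows "subalgebra P shift_invariant"
proof -
  have "space P = UNIV" "space (shift_invariant :: (nat \<Rightarrow> 'a) measure) = UNIV"
    using sets_eq_imp_space_eq[OF assms]
    by (simp_all add: space_PiM shift_invariant_def space_measure_of_conv)
  then show ?thesis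
    using assms by (auto simp: subalgebra_def sets_shift_invariant)
qed

text \<open>
  Measurability into \<open>prob_algebra borel\<close> says that \<open>\<upsilon>\<close> is a probability kernel.
\<close>

definition canonical_random_measure ::
    "(nat \<Rightarrow> 'e::polish_space) measure \<Rightarrow> ((nat \<Rightarrow> 'e) \<Rightarrow> 'e measure) \<Rightarrow> bool" where
  "canonical_random_measure P \<upsilon> \<longleftrightarrow>
     \<upsilon> \<in> shift_invariant \<rightarrow>\<^sub>M prob_algebra borel \<and>
     (\<forall>B\<in>sets borel. AE \<omega> in P.
        measure (\<upsilon> \<omega>) B = real_cond_exp P shift_invariant (\<lambda>\<omega>. indicator B (\<omega> 0)) \<omega>)"

text \<open>The empirical measure is meaningful for \<open>n \<ge> 1\<close> only; for \<open>n = 0\<close> it is the null measure.\<close>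

definition empirical_measure :: "nat \<Rightarrow> (nat \<Rightarrow> 'e::polish_space) \<Rightarrow> 'e measure" where
  "empirical_measure n \<omega> = measure_of UNIV (sets borel)
     (\<lambda>B. ennreal (1 / real n) * (\<Sum>i<n. emeasure (return borel (\<omega> i)) B))"

lemma sets_empirical_measure [simp]: "sets (empirical_measure n \<omega>) = sets borel"
  by (simp add: empirical_measure_def) (metis sets.sigma_sets_eq space_borel)

lemma emeasure_empirical_measure:
  assumes "B \<in> sets borel"
  shows "emeasure (empirical_measure n \<omega>) B =
    ennreal (1 / real n) * (\<Sum>i<n. emeasure (return borel (\<omega> i)) B)"
proof (rule emeasure_measure_of[OF empirical_measure_def])
  show "countably_additive (sets (empirical_measure n \<omega>))
     (\<lambda>B. ennreal (1 / real n) * (\<Sum>i<n. emeasure (return borel (\<omega> i)) B))"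
    unfolding countably_additive_def
  proof (intro allI impI)
    fix A :: "nat \<Rightarrow> 'a set"
    assume A: "range A \<subseteq> sets (empirical_measure n \<omega>)" "disjoint_family A"
    have "(\<Sum>k. emeasure (return borel (\<omega> i)) (A k)) = emeasure (return borel (\<omega> i)) (\<Union>(range A))" for i
      using A by (intro suminf_emeasure) auto
    then show "(\<Sum>k. ennreal (1 / real n) * (\<Sum>i<n. emeasure (return borel (\<omega> i)) (A k))) =
       ennreal (1 / real n) * (\<Sum>i<n. emeasure (return borel (\<omega> i)) (\<Union>(range A)))"
      by (subst ennreal_suminf_cmult, subst suminf_sum) auto
  qed
qed (use assms in \<open>auto simp: positive_def\<close>)

end

theory Submission
  imports Defs
begin

text \<open>
  Birkhoff's theorem gives \<open>m\<^sub>n f \<rightarrow> \<upsilon> f\<close> almost surely for one integrable \<open>f\<close> at a time. The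
  exceptional null set can be chosen independently of \<open>f \<in> gauge_continuous \<psi>\<close>: every nonnegative
  continuous function is an increasing limit of finite maxima of functions \<open>q \<cdot> 1\<^sub>U\<close> with \<open>q\<close> rational
  and \<open>U\<close> in a countable base, so convergence for these countably many maxima bounds
  \<open>liminf m\<^sub>n f\<close> from below, and convergence for \<open>\<psi>\<close> itself turns the lower bounds for \<open>C \<psi> \<plusminus> f\<close>
  into convergence of \<open>m\<^sub>n f\<close>. Hence \<open>m\<^sub>n \<rightarrow> \<upsilon>\<close> in the \<open>\<psi>\<close>-weak topology, and \<open>\<tau>\<close> preserves limits.
\<close>

section \<open>The pointwise ergodic theorem\<close>

text \<open>The maximum of the Birkhoff sums \<open>\<Sum>i<k. h ((T ^^ i) x)\<close> over \<open>k \<le> n\<close>.\<close>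

primrec max_birkhoff :: "('a \<Rightarrow> 'a) \<Rightarrow> ('a \<Rightarrow> real) \<Rightarrow> nat \<Rightarrow> 'a \<Rightarrow> real" where
  "max_birkhoff T h 0 = (\<lambda>x. 0)"
| "max_birkhoff T h (Suc n) = (\<lambda>x. max 0 (h x + max_birkhoff T h n (T x)))"

lemma max_birkhoff_nonneg: "0 \<le> max_birkhoff T h n x"
  by (cases n) auto

lemma max_birkhoff_mono_Suc: "max_birkhoff T h n x \<le> max_birkhoff T h (Suc n) x"
proof (induction n arbitrary: x)
  case (Suc n)
  from Suc[of "T x"] show ?case
    by (simp add: max_def)
qed simp

lemma max_birkhoff_mono: "m \<le> n \<Longrightarrow> max_birkhoff T h m x \<le> max_birkhoff T h n x"
  by (rule lift_Suc_mono_le[of "\<lambda>n. max_birkhoff T h n x"]) (rule max_birkhoff_mono_Suc)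

lemma sum_le_max_birkhoff: "(\<Sum>i<n. h ((T ^^ i) x)) \<le> max_birkhoff T h n x"
proof (induction n arbitrary: x)
  case (Suc n)
  have "(\<Sum>i<Suc n. h ((T ^^ i) x)) = h x + (\<Sum>i<n. h ((T ^^ i) (T x)))"
    by (subst sum.lessThan_Suc_shift) (simp add: funpow_swap1)
  also have "\<dots> \<le> h x + max_birkhoff T h n (T x)"
    using Suc by simp
  finally show ?case by simp
qed simp

text \<open>One step of the recursion changes the maximum by the fixed finite amount
  \<open>h x\<close>, up to the cut at 0, so boundedness in \<open>n\<close> is the same at
  \<open>x\<close> and at \<open>T x\<close>. This is what makes the divergence set exactly
  invariant.\<close>

lemma max_birkhoff_unbounded_iff:
  "(\<forall>K. \<exists>n. max_birkhoff T h n (T x) > K) \<longleftrightarrow> (\<forall>K. \<exists>n. max_birkhoff T h n x > K)"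
proof
  assume L: "\<forall>K. \<exists>n. max_birkhoff T h n (T x) > K"
  show "\<forall>K. \<exists>n. max_birkhoff T h n x > K"
  proof
    fix K
    obtain n where "max_birkhoff T h n (T x) > K - h x"
      using L by blast
    then have "max_birkhoff T h (Suc n) x > K"
      by (simp add: max_def)
    then show "\<exists>n. max_birkhoff T h n x > K" ..
  qed
next
  assume R: "\<forall>K. \<exists>n. max_birkhoff T h n x > K"
  show "\<forall>K. \<exists>n. max_birkhoff T h n (T x) > K"
  proof
    fix K
    \<comment> \<open>The 0 in the threshold rules out \<open>n = 0\<close> and the zero branch of
      the recursion.\<close>
    obtain n where n: "max_birkhoff T h n x > max 0 (h x + K)"
      using R by blast
    then obtain m where "n = Suc m"
      by (cases n) auto
    with n have "max_birkhoff T h m (T x) > K"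
      by (auto simp: max_def split: if_splits)
    then show "\<exists>n. max_birkhoff T h n (T x) > K" ..
  qed
qed

section \<open>Measure-preserving maps and invariant functions\<close>

text \<open>Invariance in \<open>sets_F\<close> is exact rather than up to null sets, so
  \<open>F\<close>-measurable functions are constant along every orbit in the space, not just along
  almost every one. The instance used below is the shift.\<close>

locale invariant_subalgebra = prob_space M for M :: "'a measure" +
  fixes T :: "'a \<Rightarrow> 'a" and F :: "'a measure"
  assumes T_measurable [measurable]: "T \<in> M \<rightarrow>\<^sub>M M"
    and distr_T: "distr M M T = M"
    and subalgebra: "subalgebra M F"
    and sets_F: "sets F = {A \<in> sets M. T -` A \<inter> space M = A}"
begin

sublocale finite_measure_subalgebra M F
  by unfold_locales (rule subalgebra)

lemma integrable_comp_T:
  fixes f :: "'a \<Rightarrow> real"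
  assumes "integrable M f"
  shows "integrable M (\<lambda>x. f (T x))"
  using assms integrable_distr[of T M M f] by (simp add: distr_T)

lemma integral_comp_T:
  fixes f :: "'a \<Rightarrow> real"
  assumes [measurable]: "f \<in> borel_measurable M"
  shows "(\<integral>x. f (T x) \<partial>M) = (\<integral>x. f x \<partial>M)"
  using integral_distr[of T M M f] by (simp add: distr_T)

text \<open>The level set of \<open>g\<close> through \<open>x\<close> lies in \<open>F\<close>,
  hence is invariant, and so contains \<open>T x\<close> along with \<open>x\<close>.\<close>

lemma F_measurable_comp_T:
  fixes g :: "'a \<Rightarrow> real"
  assumes g: "g \<in> borel_measurable F" and x: "x \<in> space M"
  shows "g (T x) = g x"
proof -
  have sp: "space F = space M"
    using subalgebra by (simp add: subalgebra_def)
  have "g -` {g x} \<inter> space M \<in> sets F"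
    using measurable_sets[OF g, of "{g x}"] by (simp add: sp)
  then have "T -` (g -` {g x} \<inter> space M) \<inter> space M = g -` {g x} \<inter> space M"
    by (simp add: sets_F)
  with x show ?thesis by blast
qed

lemma T_funpow_space: "x \<in> space M \<Longrightarrow> (T ^^ i) x \<in> space M"
  by (induction i) (auto intro: measurable_space[OF T_measurable])

lemma F_measurable_funpow:
  fixes g :: "'a \<Rightarrow> real"
  assumes "g \<in> borel_measurable F" "x \<in> space M"
  shows "g ((T ^^ i) x) = g x"
  by (induction i) (simp_all add: F_measurable_comp_T[OF assms(1)] T_funpow_space assms(2))

lemma max_birkhoff_integrable:
  assumes "integrable M h"
  shows "integrable M (max_birkhoff T h n)"
proof (induction n)
  case (Suc n)
  show ?case
    using assms integrable_comp_T[OF Suc] by simp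
qed simp

lemma unbounded_sets_F:
  assumes h: "integrable M h"
  shows "{x \<in> space M. \<forall>K. \<exists>n. max_birkhoff T h n x > K} \<in> sets F" (is "?A \<in> _")
proof -
  have [measurable]: "max_birkhoff T h n \<in> borel_measurable M" for n
    using max_birkhoff_integrable[OF h] by auto
  \<comment> \<open>Natural thresholds make the quantifier countable, hence the set
    measurable.\<close>
  have "?A = {x \<in> space M. \<forall>K::nat. \<exists>n. max_birkhoff T h n x > real K}"
    by (intro Collect_cong conj_cong refl) (meson less_trans reals_Archimedean2)
  also have "\<dots> \<in> sets M"
    by measurable
  finally have "?A \<in> sets M" .
  moreover have "T -` ?A \<inter> space M = ?A"
    using measurable_space[OF T_measurable] by (auto simp: max_birkhoff_unbounded_iff)
  ultimately show ?thesis
    by (simp add: sets_F)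
qed

text \<open>
  The integrals of \<open>max_birkhoff T h (Suc n) - max_birkhoff T h n\<close> over the invariant set are
  nonnegative. By invariance the second term may be composed with \<open>T\<close>, and then the integrand
  is \<open>max (- max_birkhoff T h n \<circ> T) h\<close>, which tends to \<open>h\<close> and is dominated by \<open>\<bar>h\<bar>\<close>.
\<close>

lemma maximal_ergodic:
  assumes h: "integrable M h"
  defines "A \<equiv> {x \<in> space M. \<forall>K. \<exists>n. max_birkhoff T h n x > K}"
  shows "0 \<le> (\<integral>x\<in>A. h x \<partial>M)"
proof -
  let ?G = "max_birkhoff T h"
  have A_F: "A \<in> sets F"
    unfolding A_def by (rule unbounded_sets_F[OF h])
  then have [measurable]: "A \<in> sets M"
    by (simp add: sets_F)
  have ind_T: "indicator A (T x) = (indicator A x :: real)" if "x \<in> space M" for x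
    using F_measurable_comp_T[of "indicator A"] A_F that by simp
  have G: "integrable M (?G n)" for n
    by (rule max_birkhoff_integrable[OF h])
  have [measurable]: "?G n \<in> borel_measurable M" "h \<in> borel_measurable M" for n
    using G h by auto
  have GT: "integrable M (\<lambda>x. ?G n (T x))" for n
    by (rule integrable_comp_T[OF G])
  define d where "d n x = indicator A x * (?G (Suc n) x - ?G n (T x))" for n x
  have d_alt: "d n x = indicator A x * max (- ?G n (T x)) (h x)" for n x
    by (simp add: d_def max_def)
  have [measurable]: "d n \<in> borel_measurable M" for n
    unfolding d_def by measurable
  have d_nonneg: "0 \<le> (\<integral>x. d n x \<partial>M)" for n
  proof -
    have i1: "integrable M (\<lambda>x. indicator A x * ?G m x)" for m
      using integrable_mult_indicator[OF _ G, of A] by simp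
    have i2: "integrable M (\<lambda>x. indicator A x * ?G m (T x))" for m
      using integrable_mult_indicator[OF _ GT, of A] by simp
    have "(\<integral>x. d n x \<partial>M) = (\<integral>x. indicator A x * ?G (Suc n) x \<partial>M) - (\<integral>x. indicator A x * ?G n (T x) \<partial>M)"
      unfolding d_def right_diff_distrib by (rule Bochner_Integration.integral_diff[OF i1 i2])
    moreover have "(\<integral>x. indicator A x * ?G n (T x) \<partial>M) = (\<integral>x. indicator A (T x) * ?G n (T x) \<partial>M)"
      by (intro Bochner_Integration.integral_cong) (simp_all add: ind_T)
    moreover have "\<dots> = (\<integral>x. indicator A x * ?G n x \<partial>M)"
      by (rule integral_comp_T) measurable
    moreover have "(\<integral>x. indicator A x * ?G n x \<partial>M) \<le> (\<integral>x. indicator A x * ?G (Suc n) x \<partial>M)"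
      by (intro integral_mono i1 mult_left_mono max_birkhoff_mono_Suc) simp
    ultimately show ?thesis by linarith
  qed
  have "(\<lambda>n. \<integral>x. d n x \<partial>M) \<longlonglongrightarrow> (\<integral>x. indicator A x * h x \<partial>M)"
  proof (rule integral_dominated_convergence[where w="\<lambda>x. \<bar>h x\<bar>"])
    show "AE x in M. norm (d n x) \<le> \<bar>h x\<bar>" for n
    proof (rule AE_I2)
      fix x
      show "norm (d n x) \<le> \<bar>h x\<bar>"
        using max_birkhoff_nonneg[of T h n "T x"] by (simp add: d_alt indicator_def max_def)
    qed
    show "AE x in M. (\<lambda>n. d n x) \<longlonglongrightarrow> indicator A x * h x"
    proof (rule AE_I2)
      fix x assume x: "x \<in> space M"
      show "(\<lambda>n. d n x) \<longlonglongrightarrow> indicator A x * h x"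
      proof (cases "x \<in> A")
        case True
        then have "\<forall>K. \<exists>n. ?G n (T x) > K"
          by (simp add: A_def max_birkhoff_unbounded_iff)
        \<comment> \<open>From this \<open>N\<close> on, monotonicity in \<open>n\<close> keeps the
          maximum in \<open>d_alt\<close> at \<open>h x\<close>, so the sequence is eventually
          constant.\<close>
        then obtain N where N: "?G N (T x) > - h x" by blast
        have "\<forall>\<^sub>F n in sequentially. indicator A x * h x = d n x"
          using eventually_ge_at_top[of N]
        proof eventually_elim
          case (elim n)
          with N max_birkhoff_mono[OF elim, of T h "T x"] show ?case
            by (simp add: d_alt max_def)
        qed
        then show ?thesis
          by (rule Lim_transform_eventually[OF tendsto_const])
      qed (simp add: d_def)
    qed
  qed (use h in \<open>simp_all\<close>)
  then have "0 \<le> (\<integral>x. indicator A x * h x \<partial>M)"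
    by (rule LIMSEQ_le_const) (use d_nonneg in blast)
  then show ?thesis
    by (simp add: set_lebesgue_integral_def)
qed

text \<open>The centred function \<open>h\<close> integrates to a negative multiple of
  \<open>prob A\<close> over its own invariant divergence set \<open>A\<close>, while the maximal
  inequality makes that integral nonnegative; so \<open>A\<close> is null. Off \<open>A\<close> the
  Birkhoff sums of \<open>h\<close> are bounded above, and dividing by \<open>n\<close> removes the
  bound.\<close>

lemma birkhoff_upper:
  assumes f: "integrable M f" and e: "0 < e"
  shows "AE x in M. \<forall>\<^sub>F n in sequentially.
    (\<Sum>i<n. f ((T ^^ i) x)) / real n < real_cond_exp M F f x + e"
proof -
  let ?g = "real_cond_exp M F f"
  \<comment> \<open>Only half of \<open>e\<close> is subtracted; the other half later absorbs
    \<open>K / real n\<close>.\<close>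
  define h where "h x = f x - ?g x - e / 2" for x
  define A where "A = {x \<in> space M. \<forall>K. \<exists>n. max_birkhoff T h n x > K}"
  have g: "integrable M ?g" "?g \<in> borel_measurable F"
    using f by auto
  have h: "integrable M h"
    unfolding h_def using f g(1) by auto
  have A_F: "A \<in> sets F"
    unfolding A_def by (rule unbounded_sets_F[OF h])
  then have A_M: "A \<in> sets M"
    by (simp add: sets_F)
  note si = integrable_mult_indicator[OF A_M, folded set_integrable_def]
  have "0 \<le> (\<integral>x\<in>A. h x \<partial>M)"
    unfolding A_def by (rule maximal_ergodic[OF h])
  also have "(\<integral>x\<in>A. h x \<partial>M) = (\<integral>x\<in>A. f x \<partial>M) - (\<integral>x\<in>A. ?g x \<partial>M) - (\<integral>x\<in>A. e / 2 \<partial>M)"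
    unfolding h_def
    by (subst set_integral_diff(2), intro set_integral_diff(1) si f g, intro si integrable_const,
        subst set_integral_diff(2), intro si f, intro si g, simp)
  \<comment> \<open>The integrals of \<open>f\<close> and of its conditional expectation over
    \<open>A\<close> cancel because \<open>A\<close> belongs to \<open>F\<close>.\<close>
  also have "\<dots> = - (e / 2) * prob A"
    using real_cond_exp_intA[OF f A_F] A_M by (simp add: set_lebesgue_integral_def)
  finally have "prob A = 0"
    using e measure_nonneg[of M A] by (simp add: mult_le_0_iff)
  then have "A \<in> null_sets M"
    using A_M by (simp add: null_sets_def emeasure_eq_measure)
  then have "AE x in M. x \<notin> A"
    by (rule AE_not_in)
  then show ?thesis
    using AE_space
  proof eventually_elim
    case (elim x)
    then obtain K where K: "max_birkhoff T h n x \<le> K" for n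
      by (auto simp: A_def not_less)
    have "(\<lambda>n. K / real n) \<longlonglongrightarrow> 0"
      by (rule lim_const_over_n)
    then have "\<forall>\<^sub>F n in sequentially. K / real n < e / 2"
      using e by (intro order_tendstoD) auto
    then show ?case
      using eventually_gt_at_top[of 0]
    proof eventually_elim
      case (elim n)
      \<comment> \<open>The conditional expectation is constant along the orbit, so the sum of
        \<open>f\<close> is that of \<open>h\<close> plus \<open>n\<close> equal terms.\<close>
      have "(\<Sum>i<n. f ((T ^^ i) x)) = (\<Sum>i<n. h ((T ^^ i) x) + (?g x + e / 2))"
        using \<open>x \<in> space M\<close> by (simp add: h_def F_measurable_funpow)
      also have "\<dots> = (\<Sum>i<n. h ((T ^^ i) x)) + real n * (?g x + e / 2)"
        by (simp add: sum.distrib)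
      also have "\<dots> \<le> K + real n * (?g x + e / 2)"
        using order_trans[OF sum_le_max_birkhoff K] by simp
      finally have "(\<Sum>i<n. f ((T ^^ i) x)) / real n \<le> (K + real n * (?g x + e / 2)) / real n"
        by (intro divide_right_mono) auto
      also have "\<dots> = K / real n + (?g x + e / 2)"
        using \<open>0 < n\<close> by (simp add: add_divide_distrib)
      finally show ?case
        using \<open>K / real n < e / 2\<close> by linarith
    qed
  qed
qed

text \<open>The lower bound is the upper bound for \<open>- f\<close>. Restricting the error to the
  values \<open>inverse (real (Suc k))\<close> leaves countably many almost sure events to
  intersect.\<close>

theorem birkhoff:
  assumes f: "integrable M f"
  shows "AE x in M. (\<lambda>n. (\<Sum>i<n. f ((T ^^ i) x)) / real n) \<longlonglongrightarrow> real_cond_exp M F f x"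
proof -
  let ?S = "\<lambda>f n x. (\<Sum>i<n. f ((T ^^ i) x)) / real n"
  have up: "AE x in M. \<forall>k. \<forall>\<^sub>F n in sequentially. ?S f n x < real_cond_exp M F f x + inverse (real (Suc k))"
    if "integrable M f" for f
    unfolding AE_all_countable using birkhoff_upper[OF that] by simp
  have neg_int: "integrable M (\<lambda>x. - f x)"
    using f by simp
  have "AE x in M. real_cond_exp M F (\<lambda>x. - f x) x = - real_cond_exp M F f x"
    using real_cond_exp_cmult[OF f, of "-1"] by simp
  then show ?thesis
    using up[OF f] up[OF neg_int]
  proof eventually_elim
    case (elim x)
    let ?g = "real_cond_exp M F f x"
    note neg = elim(1)
    show "(\<lambda>n. ?S f n x) \<longlonglongrightarrow> ?g"
    proof (rule tendstoI)
      fix e :: real assume "0 < e"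
      then obtain k where k: "inverse (real (Suc k)) < e"
        using reals_Archimedean by blast
      show "\<forall>\<^sub>F n in sequentially. dist (?S f n x) ?g < e"
        using elim(2,3)[rule_format, of k]
      proof eventually_elim
        case (elim n)
        with k show ?case
          by (simp add: neg sum_negf dist_real_def abs_less_iff)
      qed
    qed
  qed
qed

end


section \<open>Conditional expectation as integration against the kernel\<close>

text \<open>The kernel is tied to conditional expectations only on indicators. The passage to
  \<open>f\<close> goes through measures: on each invariant \<open>A\<close>, the law of the first
  coordinate and the mixture of the kernel agree on Borel sets, so they integrate \<open>f\<close>
  alike. For nonnegative \<open>f\<close> this can be done with extended integrals, before
  integrability under the kernel is known.\<close>

lemma canonical_random_measure_integral:
  fixes P :: "(nat \<Rightarrow> 'e::polish_space) measure" and f :: "'e \<Rightarrow> real"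
  assumes "prob_space P" and sets_P: "sets P = sets seq_space"
    and crm: "canonical_random_measure P \<upsilon>"
    and f [measurable]: "f \<in> borel_measurable borel" and nonneg: "\<And>x. 0 \<le> f x"
    and int: "integrable P (\<lambda>\<omega>. f (\<omega> 0))"
  shows "AE \<omega> in P. integrable (\<upsilon> \<omega>) f"
    and "AE \<omega> in P. real_cond_exp P shift_invariant (\<lambda>\<omega>. f (\<omega> 0)) \<omega> = (\<integral>x. f x \<partial>\<upsilon> \<omega>)"
proof -
  interpret prob_space P by fact
  interpret finite_measure_subalgebra P shift_invariant
    by unfold_locales (rule subalgebra_shift_invariant[OF sets_P])
  have \<upsilon>_pa [measurable]: "\<upsilon> \<in> shift_invariant \<rightarrow>\<^sub>M prob_algebra borel"
    using crm by (simp add: canonical_random_measure_def)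
  have \<upsilon>_F [measurable]: "\<upsilon> \<in> shift_invariant \<rightarrow>\<^sub>M subprob_algebra borel"
    by (rule measurable_prob_algebraD) measurable
  have \<upsilon>_P [measurable]: "\<upsilon> \<in> P \<rightarrow>\<^sub>M subprob_algebra borel"
    by (rule measurable_from_subalg[OF subalg \<upsilon>_F])
  have [measurable]: "(\<lambda>\<omega>. \<omega> 0) \<in> P \<rightarrow>\<^sub>M borel"
    unfolding measurable_cong_sets[OF sets_P refl] by measurable
  have sp: "space P = UNIV" "space (shift_invariant :: (nat \<Rightarrow> 'e) measure) = UNIV"
    using sets_eq_imp_space_eq[OF sets_P]
    by (simp_all add: space_PiM shift_invariant_def space_measure_of_conv)
  have \<upsilon>_prob: "prob_space (\<upsilon> \<omega>)" and \<upsilon>_sets [measurable_cong]: "sets (\<upsilon> \<omega>) = sets borel" for \<omega>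
    using measurable_space[OF \<upsilon>_pa, of \<omega>] by (simp_all add: sp space_prob_algebra)
  have f_\<upsilon>: "f \<in> borel_measurable (\<upsilon> \<omega>)" for \<omega>
    using f by (simp add: measurable_cong_sets[OF \<upsilon>_sets refl])
  let ?I = "\<lambda>\<omega>. \<integral>\<^sup>+x. ennreal (f x) \<partial>\<upsilon> \<omega>"
  have I_F [measurable]: "?I \<in> borel_measurable shift_invariant"
    by (rule nn_integral_measurable_subprob_algebra2[where N=borel]) measurable
  have I_P [measurable]: "?I \<in> borel_measurable P"
    by (rule measurable_from_subalg[OF subalg I_F])
  have cond: "(\<integral>\<^sup>+\<omega>. indicator A \<omega> * ennreal (f (\<omega> 0)) \<partial>P) = (\<integral>\<^sup>+\<omega>. indicator A \<omega> * ?I \<omega> \<partial>P)"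
    if A: "A \<in> sets shift_invariant" for A
  proof -
    have A_P [measurable]: "A \<in> sets P"
      using A subalg by (auto simp: subalgebra_def)
    \<comment> \<open>The restriction of \<open>P\<close> to \<open>A\<close>, left unnormalised;
      binding it with the kernel gives the mixture over \<open>A\<close>.\<close>
    define D where "D = density P (indicator A)"
    have sets_D [measurable_cong]: "sets D = sets P" and sp_D: "space D = UNIV"
      by (simp_all add: D_def sp)
    have "distr D borel (\<lambda>\<omega>. \<omega> 0) = bind D \<upsilon>"
    proof (rule measure_eqI)
      show "sets (distr D borel (\<lambda>\<omega>. \<omega> 0)) = sets (bind D \<upsilon>)"
        by (subst sets_bind[where N=borel]) (simp_all add: \<upsilon>_sets sp_D)
      fix B assume "B \<in> sets (distr D borel (\<lambda>\<omega>. \<omega> 0))"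
      then have B [measurable]: "B \<in> sets borel" by simp
      have iB: "integrable P (\<lambda>\<omega>. indicator B (\<omega> 0) :: real)"
        by (rule integrable_const_bound[where B=1]) (auto simp: indicator_def)
      have m [measurable]: "(\<lambda>\<omega>. measure (\<upsilon> \<omega>) B) \<in> borel_measurable P"
        by measurable
      have iM: "integrable P (\<lambda>\<omega>. measure (\<upsilon> \<omega>) B)"
        by (rule integrable_const_bound[where B=1]) (auto simp: prob_space.prob_le_1[OF \<upsilon>_prob])
      have [measurable]: "(\<lambda>\<omega>. \<omega> 0) -` B \<in> sets P"
        using measurable_sets[of "\<lambda>\<omega>. \<omega> 0" P borel B] by (simp add: sp)
      have "emeasure (distr D borel (\<lambda>\<omega>. \<omega> 0)) B
          = (\<integral>\<^sup>+\<omega>. indicator A \<omega> * indicator ((\<lambda>\<omega>. \<omega> 0) -` B) \<omega> \<partial>P)"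
        by (simp add: emeasure_distr sp_D) (simp add: D_def emeasure_density)
      also have "\<dots> = (\<integral>\<^sup>+\<omega>. ennreal (indicator A \<omega> * indicator B (\<omega> 0)) \<partial>P)"
        by (intro nn_integral_cong) (auto simp: indicator_def)
      also have "\<dots> = ennreal (\<integral>\<omega>. indicator A \<omega> * indicator B (\<omega> 0) \<partial>P)"
        using integrable_mult_indicator[OF A_P iB] by (intro nn_integral_eq_integral) simp_all
      also have "(\<integral>\<omega>. indicator A \<omega> * indicator B (\<omega> 0) \<partial>P)
          = (\<integral>\<omega>\<in>A. real_cond_exp P shift_invariant (\<lambda>\<omega>. indicator B (\<omega> 0)) \<omega> \<partial>P)"
        using real_cond_exp_intA[OF iB A] by (simp add: set_lebesgue_integral_def)
      also have "\<dots> = (\<integral>\<omega>. indicator A \<omega> * measure (\<upsilon> \<omega>) B \<partial>P)"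
        unfolding set_lebesgue_integral_def
      proof (rule integral_cong_AE)
        have "AE \<omega> in P. measure (\<upsilon> \<omega>) B
            = real_cond_exp P shift_invariant (\<lambda>\<omega>. indicator B (\<omega> 0)) \<omega>"
          using crm B by (auto simp: canonical_random_measure_def)
        then show "AE \<omega> in P. indicator A \<omega> *\<^sub>R real_cond_exp P shift_invariant (\<lambda>\<omega>. indicator B (\<omega> 0)) \<omega>
            = indicator A \<omega> * measure (\<upsilon> \<omega>) B"
          by eventually_elim simp
      qed measurable
      also have "ennreal \<dots> = (\<integral>\<^sup>+\<omega>. ennreal (indicator A \<omega> * measure (\<upsilon> \<omega>) B) \<partial>P)"
        using integrable_mult_indicator[OF A_P iM] by (intro nn_integral_eq_integral[symmetric]) simp_all
      also have "\<dots> = (\<integral>\<^sup>+\<omega>. indicator A \<omega> * emeasure (\<upsilon> \<omega>) B \<partial>P)"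
        by (intro nn_integral_cong)
          (auto simp: indicator_def finite_measure.emeasure_eq_measure
            prob_space.finite_measure[OF \<upsilon>_prob])
      also have "\<dots> = (\<integral>\<^sup>+\<omega>. emeasure (\<upsilon> \<omega>) B \<partial>D)"
        unfolding D_def by (subst nn_integral_density) simp_all
      also have "\<dots> = emeasure (bind D \<upsilon>) B"
        by (subst emeasure_bind[where N=borel]) (simp_all add: sp_D)
      finally show "emeasure (distr D borel (\<lambda>\<omega>. \<omega> 0)) B = emeasure (bind D \<upsilon>) B" .
    qed
    then have "(\<integral>\<^sup>+x. ennreal (f x) \<partial>distr D borel (\<lambda>\<omega>. \<omega> 0)) = (\<integral>\<^sup>+x. ennreal (f x) \<partial>bind D \<upsilon>)"
      by simp
    also have "\<dots> = (\<integral>\<^sup>+\<omega>. ?I \<omega> \<partial>D)"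
      by (rule nn_integral_bind[where B=borel]) measurable
    finally have "(\<integral>\<^sup>+\<omega>. ennreal (f (\<omega> 0)) \<partial>D) = (\<integral>\<^sup>+\<omega>. ?I \<omega> \<partial>D)"
      by (simp add: nn_integral_distr)
    then show ?thesis
      unfolding D_def by (simp add: nn_integral_density)
  qed
  have "(\<integral>\<^sup>+\<omega>. ?I \<omega> \<partial>P) = (\<integral>\<^sup>+\<omega>. ennreal (f (\<omega> 0)) \<partial>P)"
    using cond[OF sets.top] by (simp add: sp)
  also have "\<dots> < \<infinity>"
    using int by (simp add: integrable_iff_bounded nonneg)
  finally have I_fin: "(\<integral>\<^sup>+\<omega>. ?I \<omega> \<partial>P) < \<infinity>" .
  \<comment> \<open>The finite expectation comes from \<open>cond\<close> with the whole space as
    \<open>A\<close>.\<close>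
  then have AE_fin: "AE \<omega> in P. ?I \<omega> \<noteq> \<infinity>"
    by (intro nn_integral_PInf_AE) auto
  then show "AE \<omega> in P. integrable (\<upsilon> \<omega>) f"
    by eventually_elim (auto intro!: integrableI_nonneg simp: nonneg less_top f_\<upsilon>)
  \<comment> \<open>This holds for every \<open>\<omega>\<close>: where \<open>?I\<close> is
    infinite, both the Bochner integral and \<open>enn2real\<close> take the default value 0.
    Measurability of the integral thus needs no exceptional set.\<close>
  have eq: "(\<integral>x. f x \<partial>\<upsilon> \<omega>) = enn2real (?I \<omega>)" for \<omega>
    by (rule integral_eq_nn_integral) (simp_all add: nonneg f_\<upsilon>)
  have AE_enn: "AE \<omega> in P. ennreal (\<integral>x. f x \<partial>\<upsilon> \<omega>) = ?I \<omega>"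
    using AE_fin by eventually_elim (simp add: eq less_top)
  show "AE \<omega> in P. real_cond_exp P shift_invariant (\<lambda>\<omega>. f (\<omega> 0)) \<omega> = (\<integral>x. f x \<partial>\<upsilon> \<omega>)"
  proof (rule real_cond_exp_charact)
    show meas: "(\<lambda>\<omega>. \<integral>x. f x \<partial>\<upsilon> \<omega>) \<in> borel_measurable shift_invariant"
      unfolding eq by measurable
    have meas_P [measurable]: "(\<lambda>\<omega>. \<integral>x. f x \<partial>\<upsilon> \<omega>) \<in> borel_measurable P"
      by (rule measurable_from_subalg[OF subalg meas])
    have nn: "0 \<le> (\<integral>x. f x \<partial>\<upsilon> \<omega>)" for \<omega>
      by (simp add: nonneg)
    show int_I: "integrable P (\<lambda>\<omega>. \<integral>x. f x \<partial>\<upsilon> \<omega>)"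
      using I_fin nn_integral_cong_AE[OF AE_enn] by (intro integrableI_nonneg) (simp_all add: nonneg)
    fix A assume A: "A \<in> sets (shift_invariant :: (nat \<Rightarrow> 'e) measure)"
    then have A_P [measurable]: "A \<in> sets P"
      using subalg by (auto simp: subalgebra_def)
    have "ennreal (\<integral>\<omega>\<in>A. f (\<omega> 0) \<partial>P) = (\<integral>\<^sup>+\<omega>. ennreal (indicator A \<omega> * f (\<omega> 0)) \<partial>P)"
      unfolding set_lebesgue_integral_def using integrable_mult_indicator[OF A_P int]
      by (subst nn_integral_eq_integral[symmetric]) (simp_all add: nonneg)
    also have "\<dots> = (\<integral>\<^sup>+\<omega>. indicator A \<omega> * ennreal (f (\<omega> 0)) \<partial>P)"
      by (intro nn_integral_cong) (auto simp: indicator_def)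
    also have "\<dots> = (\<integral>\<^sup>+\<omega>. indicator A \<omega> * ?I \<omega> \<partial>P)"
      by (rule cond[OF A])
    also have "\<dots> = (\<integral>\<^sup>+\<omega>. ennreal (indicator A \<omega> * (\<integral>x. f x \<partial>\<upsilon> \<omega>)) \<partial>P)"
      using AE_enn by (intro nn_integral_cong_AE) (auto simp: indicator_def)
    also have "\<dots> = ennreal (\<integral>\<omega>\<in>A. (\<integral>x. f x \<partial>\<upsilon> \<omega>) \<partial>P)"
      unfolding set_lebesgue_integral_def using integrable_mult_indicator[OF A_P int_I]
      by (subst nn_integral_eq_integral[symmetric]) (simp_all add: nn)
    finally show "(\<integral>\<omega>\<in>A. f (\<omega> 0) \<partial>P) = (\<integral>\<omega>\<in>A. (\<integral>x. f x \<partial>\<upsilon> \<omega>) \<partial>P)"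
      by (subst (asm) ennreal_inj)
        (auto simp: set_lebesgue_integral_def nonneg intro!: integral_nonneg_AE)
  qed (rule int)
qed


section \<open>A countable class determining convergence\<close>

text \<open>Countability survives the passage to maxima because a countable set has only countably
  many finite subsets. Boundedness is recorded so that the members are integrable under every
  probability law.\<close>

lemma countable_class_below_continuous:
  obtains H :: "('e::second_countable_topology \<Rightarrow> real) set"
  where "countable H"
    and "H \<subseteq> borel_measurable borel"
    and "\<forall>h\<in>H. \<forall>x. 0 \<le> h x"
    and "\<forall>h\<in>H. \<exists>C. \<forall>x. h x \<le> C"
    and "\<forall>f. continuous_on UNIV f \<longrightarrow> (\<forall>x. 0 \<le> f x) \<longrightarrow>
           (\<exists>h :: nat \<Rightarrow> 'e \<Rightarrow> real. \<forall>x. (\<forall>n. h n \<in> H \<and> h n x \<le> f x) \<and> (\<lambda>n. h n x) \<longlonglongrightarrow> f x)"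
proof -
  obtain B :: "'e set set" where B: "countable B" "topological_basis B"
    using ex_countable_basis by blast
  \<comment> \<open>The zero function ensures that some member of \<open>D\<close> lies below any
    given nonnegative \<open>f\<close>, so the enumeration of \<open>Df\<close> below is
    legitimate.\<close>
  define D :: "('e \<Rightarrow> real) set"
    where "D = insert (\<lambda>_. 0) ((\<lambda>(q, U) x. q * indicator U x) ` ((\<rat> \<inter> {0..}) \<times> B))"
  define H :: "('e \<Rightarrow> real) set"
    where "H = (\<lambda>S x. Max ((\<lambda>d. d x) ` S)) ` {S. finite S \<and> S \<subseteq> D \<and> S \<noteq> {}}"
  have "countable D"
    unfolding D_def
    by (intro countable_insert countable_image countable_SIGMA B countable_Int1 countable_rat)
  have D_meas: "d \<in> borel_measurable borel" if "d \<in> D" for d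
    using that B(2) by (auto simp: D_def dest: topological_basis_open)
  have D_nonneg: "0 \<le> d x" if "d \<in> D" for d x
    using that by (auto simp: D_def)
  have D_bdd: "\<exists>C. \<forall>x. d x \<le> C" if "d \<in> D" for d
    using that unfolding D_def
  proof (elim insertE imageE)
    fix p assume "d = (\<lambda>(q, U) x. q * indicator U x) p" and "p \<in> (\<rat> \<inter> {0..}) \<times> B"
    then show ?thesis
      by (cases p) (auto simp: indicator_def intro!: exI[of _ "fst p"])
  qed auto
  show ?thesis
  proof (rule that[of H]; (intro ballI allI impI subsetI)?)
    have "countable {S. finite S \<and> S \<subseteq> D}"
      using countable_Collect_finite_subset[OF \<open>countable D\<close>] by (simp add: conj_commute)
    then show "countable H"
      unfolding H_def by (intro countable_image) (rule countable_subset, auto)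
  next
    fix h assume "h \<in> H"
    then obtain S where S: "finite S" "S \<subseteq> D" "S \<noteq> {}" and h: "h = (\<lambda>x. Max ((\<lambda>d. d x) ` S))"
      by (auto simp: H_def)
    show "h \<in> borel_measurable borel"
      unfolding h using S D_meas by (intro borel_measurable_Max) auto
    show "0 \<le> h x" for x
      using S D_nonneg by (auto simp: h Max_ge_iff)
    obtain C where C: "\<And>d x. d \<in> D \<Longrightarrow> d x \<le> C d"
      using D_bdd by metis
    have "d x \<le> Max (C ` S)" if "d \<in> S" for d x
    proof -
      have "d x \<le> C d"
        using S(2) that by (intro C) auto
      also have "C d \<le> Max (C ` S)"
        using S(1) that by simp
      finally show ?thesis .
    qed
    then have "h x \<le> Max (C ` S)" for x
      unfolding h using S by (intro Max.boundedI) auto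
    then show "\<exists>C. \<forall>x. h x \<le> C" by blast
  next
    fix f :: "'e \<Rightarrow> real" assume f: "continuous_on UNIV f" and "\<forall>x. 0 \<le> f x"
    then have nonneg: "0 \<le> f x" for x by blast
    define Df where "Df = {d \<in> D. \<forall>x. d x \<le> f x}"
    have "(\<lambda>_. 0) \<in> Df"
      using nonneg by (auto simp: Df_def D_def)
    then have ne: "Df \<noteq> {}" by blast
    have cf: "countable Df"
      unfolding Df_def by (rule countable_subset[OF _ \<open>countable D\<close>]) auto
    \<comment> \<open>The running maximum along an enumeration of \<open>Df\<close>, possibly with
      repetitions; it increases with \<open>n\<close>.\<close>
    define h where "h n x = Max ((\<lambda>d. d x) ` (from_nat_into Df ` {..n}))" for n :: nat and x
    have e: "from_nat_into Df i \<in> Df" for i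
      by (rule from_nat_into[OF ne])
    have hH: "h n \<in> H" for n
      unfolding H_def h_def[abs_def] using e by (intro imageI) (auto simp: Df_def)
    have hf: "h n x \<le> f x" for n x
      unfolding h_def using e by (intro Max.boundedI) (auto simp: Df_def)
    have "(\<lambda>n. h n x) \<longlonglongrightarrow> f x" for x
    proof (rule order_tendstoI)
      fix a assume "a < f x"
      \<comment> \<open>The zero function beats a negative \<open>a\<close>. Otherwise a rational
        \<open>q\<close> between \<open>a\<close> and \<open>f x\<close> is nonnegative, and
        \<open>q\<close> times the indicator of a basic neighbourhood \<open>U\<close> of
        \<open>x\<close> inside \<open>{y. q < f y}\<close> is below \<open>f\<close>: on
        \<open>U\<close> by the choice of \<open>U\<close>, elsewhere since \<open>f\<close> is
        nonnegative.\<close>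
      obtain d where d: "d \<in> Df" "a < d x"
      proof (cases "a < 0")
        case True
        then show ?thesis using that \<open>(\<lambda>_. 0) \<in> Df\<close> by fastforce
      next
        case False
        obtain q where q: "q \<in> \<rat>" "a < q" "q < f x"
          using Rats_dense_in_real[OF \<open>a < f x\<close>] by blast
        have "open {y. q < f y}"
          using f by (intro open_Collect_less) auto
        then obtain U where U: "U \<in> B" "x \<in> U" "U \<subseteq> {y. q < f y}"
          using topological_basisE[OF B(2), of _ x] q(3) by (metis mem_Collect_eq)
        have "(\<lambda>y. q * indicator U y) \<in> D"
          unfolding D_def using q False U(1)
          by (intro insertI2 image_eqI[of _ _ "(q, U)"]) auto
        moreover have "q * indicator U y \<le> f y" for y
          using U(3) nonneg[of y] by (auto simp: indicator_def less_imp_le)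
        ultimately show ?thesis
          using q(2) U(2) by (intro that[of "\<lambda>y. q * indicator U y"]) (auto simp: Df_def)
      qed
      obtain N where N: "d = from_nat_into Df N"
        using from_nat_into_surj[OF cf d(1)] by metis
      show "\<forall>\<^sub>F n in sequentially. a < h n x"
        using eventually_ge_at_top[of N]
      proof eventually_elim
        case (elim n)
        then have "d x \<le> h n x"
          unfolding h_def N by (intro Max_ge) auto
        with d(2) show ?case by simp
      qed
    next
      fix a assume "f x < a"
      then show "\<forall>\<^sub>F n in sequentially. h n x < a"
        using hf by (auto intro: always_eventually le_less_trans)
    qed
    then show "\<exists>h :: nat \<Rightarrow> 'e \<Rightarrow> real. \<forall>x. (\<forall>n. h n \<in> H \<and> h n x \<le> f x) \<and> (\<lambda>n. h n x) \<longlonglongrightarrow> f x"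
      using hH hf by blast
  qed
qed

section \<open>From the countable class to all gauge-bounded continuous functions\<close>

text \<open>Dominated convergence under \<open>\<nu>\<close> alone selects a single \<open>k\<close>
  whose integral already exceeds \<open>a\<close>. Convergence for that \<open>h k\<close> carries
  the bound to \<open>\<mu> n\<close>, and \<open>h k\<close> lies below \<open>f\<close>.\<close>

lemma integral_gt_eventually:
  fixes f :: "'e::topological_space \<Rightarrow> real" and h :: "nat \<Rightarrow> 'e \<Rightarrow> real"
  assumes sets: "\<And>n. sets (\<mu> n) = sets borel" "sets \<nu> = sets borel"
    and f: "\<And>n. integrable (\<mu> n) f" "integrable \<nu> f"
    and h: "\<And>k. h k \<in> borel_measurable borel" "\<And>k x. 0 \<le> h k x" "\<And>k x. h k x \<le> f x"
    and lim: "\<And>x. (\<lambda>k. h k x) \<longlonglongrightarrow> f x"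
    and conv: "\<And>k. (\<lambda>n. \<integral>x. h k x \<partial>\<mu> n) \<longlonglongrightarrow> (\<integral>x. h k x \<partial>\<nu>)"
    and a: "a < (\<integral>x. f x \<partial>\<nu>)"
  shows "\<forall>\<^sub>F n in sequentially. a < (\<integral>x. f x \<partial>\<mu> n)"
proof -
  have hm: "h k \<in> borel_measurable (\<mu> n)" "h k \<in> borel_measurable \<nu>" for k n
    using h(1)[of k]
    by (simp_all add: measurable_cong_sets[OF sets(1) refl] measurable_cong_sets[OF sets(2) refl])
  have "(\<lambda>k. \<integral>x. h k x \<partial>\<nu>) \<longlonglongrightarrow> (\<integral>x. f x \<partial>\<nu>)"
    by (rule integral_dominated_convergence[where w=f]) (simp_all add: h(2,3) lim f(2) hm borel_measurable_integrable)
  then obtain k where "a < (\<integral>x. h k x \<partial>\<nu>)"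
    using order_tendstoD(1)[OF _ a] eventually_happens sequentially_bot by blast
  then have "\<forall>\<^sub>F n in sequentially. a < (\<integral>x. h k x \<partial>\<mu> n)"
    using conv[of k] by (intro order_tendstoD)
  then show ?thesis
  proof eventually_elim
    case (elim n)
    have "integrable (\<mu> n) (h k)"
      by (rule Bochner_Integration.integrable_bound[OF f(1)[of n] hm(1)])
        (simp add: h(2) order_trans[OF h(3) abs_ge_self])
    then have "(\<integral>x. h k x \<partial>\<mu> n) \<le> (\<integral>x. f x \<partial>\<mu> n)"
      by (rule integral_mono[OF _ f(1) h(3)])
    with elim show ?case by simp
  qed
qed

text \<open>Induction over the generation of open sets: finite intersections and unions preserve
  being eventually entered. The subbasic sets include membership in
  \<open>prob_measures_gauge \<psi>\<close>, whence the second assumption.\<close>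

lemma psi_weak_limitinI:
  assumes "\<nu> \<in> prob_measures_gauge \<psi>"
    and "\<forall>\<^sub>F n in sequentially. \<mu> n \<in> prob_measures_gauge \<psi>"
    and "\<And>f. f \<in> gauge_continuous \<psi> \<Longrightarrow> (\<lambda>n. \<integral>x. f x \<partial>\<mu> n) \<longlonglongrightarrow> (\<integral>x. f x \<partial>\<nu>)"
  shows "limitin (psi_weak_topology \<psi>) \<mu> \<nu> sequentially"
  unfolding limitin_def
proof (intro conjI allI impI)
  show "\<nu> \<in> topspace (psi_weak_topology \<psi>)"
    using assms(1) by simp
  fix V assume "openin (psi_weak_topology \<psi>) V \<and> \<nu> \<in> V"
  then have "generate_topology_on {{\<mu> \<in> prob_measures_gauge \<psi>. (\<integral>x. f x \<partial>\<mu>) \<in> U} | f U.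
        f \<in> gauge_continuous \<psi> \<and> open U} V" and "\<nu> \<in> V"
    by (simp_all add: psi_weak_topology_def openin_topology_generated_by_iff)
  then show "\<forall>\<^sub>F n in sequentially. \<mu> n \<in> V"
  proof induction
    case (Int a b)
    then show ?case by (auto intro: eventually_conj)
  next
    case (UN K)
    then obtain k where "k \<in> K" "\<nu> \<in> k" by blast
    with UN.IH have "\<forall>\<^sub>F n in sequentially. \<mu> n \<in> k" by blast
    then show ?case
      by eventually_elim (use \<open>k \<in> K\<close> in blast)
  next
    case (Basis s)
    then obtain f U where s: "s = {\<mu> \<in> prob_measures_gauge \<psi>. (\<integral>x. f x \<partial>\<mu>) \<in> U}"
      and f: "f \<in> gauge_continuous \<psi>" and U: "open U"
      by auto
    have "\<forall>\<^sub>F n in sequentially. (\<integral>x. f x \<partial>\<mu> n) \<in> U"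
      using assms(3)[OF f] U Basis.prems s by (auto intro: topological_tendstoD)
    with assms(2) show ?case
      by eventually_elim (simp add: s)
  qed simp
qed

text \<open>Applied to \<open>f + C \<psi> \<ge> 0\<close> and \<open>C \<psi> - f \<ge> 0\<close>, approximation from below suffices.\<close>

lemma gauge_integral_tendsto:
  fixes \<psi> :: "'e::polish_space \<Rightarrow> real"
  assumes \<psi>: "continuous_on UNIV \<psi>" "\<And>x. 1 \<le> \<psi> x"
    and \<nu>: "\<nu> \<in> prob_measures_gauge \<psi>" and \<mu>: "\<And>n. \<mu> n \<in> prob_measures_gauge \<psi>"
    and meas: "H \<subseteq> borel_measurable borel"
    and nonneg: "\<forall>h\<in>H. \<forall>x. 0 \<le> h x"
    and below: "\<forall>f. continuous_on UNIV f \<longrightarrow> (\<forall>x. 0 \<le> f x) \<longrightarrow>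
      (\<exists>h :: nat \<Rightarrow> 'e \<Rightarrow> real. \<forall>x. (\<forall>n. h n \<in> H \<and> h n x \<le> f x) \<and> (\<lambda>n. h n x) \<longlonglongrightarrow> f x)"
    and conv: "\<forall>h\<in>H. (\<lambda>n. \<integral>x. h x \<partial>\<mu> n) \<longlonglongrightarrow> (\<integral>x. h x \<partial>\<nu>)"
    and conv_\<psi>: "(\<lambda>n. \<integral>x. \<psi> x \<partial>\<mu> n) \<longlonglongrightarrow> (\<integral>x. \<psi> x \<partial>\<nu>)"
    and f: "f \<in> gauge_continuous \<psi>"
  shows "(\<lambda>n. \<integral>x. f x \<partial>\<mu> n) \<longlonglongrightarrow> (\<integral>x. f x \<partial>\<nu>)"
proof -
  have pos: "0 < \<psi> x" for x
    using \<psi>(2)[of x] by linarith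
  have \<psi>_gc: "\<psi> \<in> gauge_continuous \<psi>"
    using \<psi>(1) pos by (simp add: gauge_continuous_def less_imp_neq[symmetric] image_constant_conv)
  note int = integrable_gauge_continuous[OF \<psi>]
  have sets: "sets (\<mu> n) = sets borel" "sets \<nu> = sets borel" for n
    using \<mu> \<nu> by (simp_all add: prob_measures_gauge_def space_prob_algebra)
  \<comment> \<open>Stated for an arbitrary gauge-bounded function because it is also applied to
    \<open>- f\<close>.\<close>
  have lower: "\<forall>\<^sub>F n in sequentially. a < (\<integral>x. f x \<partial>\<mu> n)"
    if f: "f \<in> gauge_continuous \<psi>" and a: "a < (\<integral>x. f x \<partial>\<nu>)" for f a
  proof -
    obtain C where C: "\<And>x. \<bar>f x / \<psi> x\<bar> \<le> C"
      using f by (auto simp: gauge_continuous_def bounded_iff)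
    have fc: "continuous_on UNIV f"
      using f by (simp add: gauge_continuous_def)
    define g where "g x = f x + C * \<psi> x" for x
    have g0: "0 \<le> g x" for x
      using C[of x] pos[of x] by (simp add: g_def divide_le_eq abs_le_iff)
    have gi: "integrable (\<mu> n) g" "integrable \<nu> g" for n
      unfolding g_def using int[OF \<mu> f] int[OF \<nu> f] int[OF \<mu> \<psi>_gc] int[OF \<nu> \<psi>_gc] by auto
    have g_eq: "(\<integral>x. g x \<partial>\<mu> n) = (\<integral>x. f x \<partial>\<mu> n) + C * (\<integral>x. \<psi> x \<partial>\<mu> n)"
        "(\<integral>x. g x \<partial>\<nu>) = (\<integral>x. f x \<partial>\<nu>) + C * (\<integral>x. \<psi> x \<partial>\<nu>)" for n
      unfolding g_def using int[OF \<mu> f] int[OF \<nu> f] int[OF \<mu> \<psi>_gc] int[OF \<nu> \<psi>_gc] by auto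
    have "continuous_on UNIV g"
      unfolding g_def by (intro continuous_intros fc \<psi>)
    then have "\<exists>h :: nat \<Rightarrow> 'e \<Rightarrow> real. \<forall>x. (\<forall>n. h n \<in> H \<and> h n x \<le> g x) \<and> (\<lambda>n. h n x) \<longlonglongrightarrow> g x"
      using below g0 by simp
    then obtain h :: "nat \<Rightarrow> 'e \<Rightarrow> real"
      where h: "\<And>n. h n \<in> H" "\<And>n x. h n x \<le> g x" "\<And>x. (\<lambda>n. h n x) \<longlonglongrightarrow> g x"
      by auto
    \<comment> \<open>The midpoint leaves the margin \<open>b - a\<close> for the error of
      \<open>C\<close> times the integral of \<open>\<psi>\<close> when that term is subtracted
      again.\<close>
    define b where "b = (a + (\<integral>x. f x \<partial>\<nu>)) / 2"
    have b: "a < b" "b < (\<integral>x. f x \<partial>\<nu>)"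
      using a by (simp_all add: b_def)
    have "\<forall>\<^sub>F n in sequentially. b + C * (\<integral>x. \<psi> x \<partial>\<nu>) < (\<integral>x. g x \<partial>\<mu> n)"
    proof (rule integral_gt_eventually[OF sets gi _ _ h(2,3)])
      show "h k \<in> borel_measurable borel" "0 \<le> h k x"
        "(\<lambda>n. \<integral>x. h k x \<partial>\<mu> n) \<longlonglongrightarrow> (\<integral>x. h k x \<partial>\<nu>)" for k x
        using h(1)[of k] meas nonneg conv by auto
      show "b + C * (\<integral>x. \<psi> x \<partial>\<nu>) < (\<integral>x. g x \<partial>\<nu>)"
        using b(2) by (simp add: g_eq)
    qed
    moreover have "(\<lambda>n. C * (\<integral>x. \<psi> x \<partial>\<mu> n)) \<longlonglongrightarrow> C * (\<integral>x. \<psi> x \<partial>\<nu>)"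
      by (intro tendsto_intros conv_\<psi>)
    then have "\<forall>\<^sub>F n in sequentially. C * (\<integral>x. \<psi> x \<partial>\<mu> n) < C * (\<integral>x. \<psi> x \<partial>\<nu>) + (b - a)"
      using b(1) by (intro order_tendstoD) auto
    ultimately show ?thesis
      by eventually_elim (simp add: g_eq)
  qed
  show ?thesis
  proof (rule order_tendstoI)
    fix a assume "(\<integral>x. f x \<partial>\<nu>) < a"
    moreover have "(\<lambda>x. - f x) \<in> gauge_continuous \<psi>"
      using f by (auto simp: gauge_continuous_def bounded_iff intro!: continuous_intros)
    ultimately have "\<forall>\<^sub>F n in sequentially. - a < (\<integral>x. - f x \<partial>\<mu> n)"
      by (intro lower) auto
    then show "\<forall>\<^sub>F n in sequentially. (\<integral>x. f x \<partial>\<mu> n) < a"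
      by simp
  qed (rule lower[OF f])
qed


section \<open>Empirical measures\<close>

text \<open>The empirical measure is the law of a uniformly chosen coordinate of
  \<open>\<omega>\<close>. In this form integrals become finite averages by change of
  variables.\<close>

lemma empirical_measure_eq_distr:
  assumes "0 < n"
  shows "empirical_measure n \<omega> = distr (uniform_count_measure {..<n}) borel \<omega>"
proof (rule measure_eqI)
  fix B assume "B \<in> sets (empirical_measure n \<omega>)"
  then have B: "B \<in> sets borel" by simp
  have "(\<Sum>i<n. emeasure (return borel (\<omega> i)) B) = (\<Sum>i<n. of_bool (\<omega> i \<in> B))"
    using B by (intro sum.cong) (auto simp: indicator_def)
  also have "\<dots> = of_nat (card (\<omega> -` B \<inter> {..<n}))"
    by (simp add: sum.If_cases of_bool_def) (simp add: Int_commute vimage_def)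
  finally have "emeasure (empirical_measure n \<omega>) B = ennreal (1 / n) * of_nat (card (\<omega> -` B \<inter> {..<n}))"
    using B by (simp add: emeasure_empirical_measure)
  also have "\<dots> = ennreal (real (card (\<omega> -` B \<inter> {..<n})) / real n)"
    by (simp add: ennreal_of_nat_eq_real_of_nat ennreal_mult[symmetric] del: ennreal_1)
  also have "\<dots> = emeasure (distr (uniform_count_measure {..<n}) borel \<omega>) B"
    using B by (subst emeasure_distr)
      (auto simp: emeasure_uniform_count_measure space_uniform_count_measure)
  finally show "emeasure (empirical_measure n \<omega>) B
      = emeasure (distr (uniform_count_measure {..<n}) borel \<omega>) B" .
qed simp

lemma integral_empirical_measure:
  fixes f :: "'e::polish_space \<Rightarrow> real"
  assumes "0 < n" and "f \<in> borel_measurable borel"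
  shows "(\<integral>x. f x \<partial>empirical_measure n \<omega>) = (\<Sum>i<n. f (\<omega> i)) / real n"
  using assms
  by (simp add: empirical_measure_eq_distr integral_distr integral_uniform_count_measure)

lemma empirical_measure_in_prob_measures_gauge:
  assumes "0 < n" and \<psi>: "\<psi> \<in> borel_measurable borel"
  shows "empirical_measure n \<omega> \<in> prob_measures_gauge \<psi>"
proof -
  have "prob_space (uniform_count_measure {..<n})"
    using assms(1) by (intro prob_space_uniform_count_measure) auto
  then have "prob_space (empirical_measure n \<omega>)"
    unfolding empirical_measure_eq_distr[OF assms(1)] by (rule prob_space.prob_space_distr) simp
  moreover have "(\<integral>\<^sup>+x. ennreal (\<psi> x) \<partial>empirical_measure n \<omega>) < \<infinity>"
    using assms unfolding empirical_measure_eq_distr[OF assms(1)]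
    by (subst nn_integral_distr)
      (simp_all add: uniform_count_measure_def nn_integral_point_measure_finite ennreal_mult_less_top)
  ultimately show ?thesis
    by (simp add: prob_measures_gauge_def space_prob_algebra)
qed


section \<open>Strong consistency\<close>

text \<open>Stationarity compares two laws on \<open>seq_space\<close>. As \<open>P\<close> has the
  same measurable sets, the law of the identity is \<open>P\<close> itself, so the shift preserves
  \<open>P\<close>.\<close>

lemma invariant_subalgebra_shift:
  fixes P :: "(nat \<Rightarrow> 'e::polish_space) measure"
  assumes "prob_space P" and sets_P: "sets P = sets seq_space" and "stationary P"
  shows "invariant_subalgebra P shift_seq shift_invariant"
proof -
  interpret prob_space P by fact
  have sp: "space P = UNIV"
    using sets_eq_imp_space_eq[OF sets_P] by (simp add: space_PiM)
  show ?thesis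
  proof
    have "shift_seq \<in> seq_space \<rightarrow>\<^sub>M (seq_space :: (nat \<Rightarrow> 'e) measure)"
      unfolding shift_seq_def[abs_def] by (rule measurable_PiM_single') auto
    then show "shift_seq \<in> P \<rightarrow>\<^sub>M P"
      using measurable_cong_sets[OF sets_P sets_P] by simp
    have "distr P P shift_seq = distr P seq_space shift_seq"
      by (intro distr_cong) (simp_all add: sets_P)
    also have "\<dots> = distr P seq_space (\<lambda>\<omega>. \<omega>)"
      using \<open>stationary P\<close> by (simp add: stationary_def)
    also have "\<dots> = P"
      by (rule distr_id2) (simp add: sets_P)
    finally show "distr P P shift_seq = P" .
  qed (simp_all add: subalgebra_shift_invariant sets_P sets_shift_invariant sp)
qed

lemma shift_seq_funpow: "(shift_seq ^^ i) \<omega> = (\<lambda>n. \<omega> (n + i))"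
  by (induction i) (auto simp: shift_seq_def)

text \<open>Birkhoff's theorem for the shift and the function \<open>f (\<omega> 0)\<close>, whose
  orbit averages are the empirical integrals. The index \<open>Suc n\<close> skips the null measure
  at 0.\<close>

lemma integral_empirical_measure_tendsto:
  fixes P :: "(nat \<Rightarrow> 'e::polish_space) measure" and f :: "'e \<Rightarrow> real"
  assumes "prob_space P" "sets P = sets seq_space" "stationary P"
    and "canonical_random_measure P \<upsilon>"
    and f: "f \<in> borel_measurable borel" and nonneg: "\<And>x. 0 \<le> f x"
    and int: "integrable P (\<lambda>\<omega>. f (\<omega> 0))"
  shows "AE \<omega> in P. (\<lambda>n. \<integral>x. f x \<partial>empirical_measure (Suc n) \<omega>) \<longlonglongrightarrow> (\<integral>x. f x \<partial>\<upsilon> \<omega>)"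
proof -
  interpret invariant_subalgebra P shift_seq shift_invariant
    using assms by (intro invariant_subalgebra_shift)
  show ?thesis
    using birkhoff[OF int] canonical_random_measure_integral(2)[OF assms(1,2,4) f nonneg int]
  proof eventually_elim
    case (elim \<omega>)
    then have "(\<lambda>n. (\<Sum>i<n. f (\<omega> i)) / real n) \<longlonglongrightarrow> (\<integral>x. f x \<partial>\<upsilon> \<omega>)"
      by (simp add: shift_seq_funpow)
    from LIMSEQ_Suc[OF this] show ?case
      by (simp add: integral_empirical_measure f del: sum.lessThan_Suc of_nat_Suc)
  qed
qed

text \<open>Since \<open>\<tau>\<close> is a total function in the logic but continuous only on
  \<open>prob_measures_gauge \<psi>\<close>, the conclusion also records that its argument
  \<open>\<upsilon> \<omega>\<close> almost surely lies there.\<close>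

theorem corollary1:
  fixes \<psi> :: "'e::polish_space \<Rightarrow> real"
    and P :: "(nat \<Rightarrow> 'e) measure"
    and \<upsilon> :: "(nat \<Rightarrow> 'e) \<Rightarrow> 'e measure"
    and \<tau> :: "'e measure \<Rightarrow> 't::polish_space"
  assumes "continuous_on UNIV \<psi>" and "\<And>x. 1 \<le> \<psi> x"
    and "prob_space P" and "sets P = sets seq_space"
    and "canonical_random_measure P \<upsilon>"
    and "stationary P"
    and "distr P borel (\<lambda>\<omega>. \<omega> 0) \<in> prob_measures_gauge \<psi>"
    and "continuous_map (psi_weak_topology \<psi>) euclidean \<tau>"
  shows "AE \<omega> in completion P. \<upsilon> \<omega> \<in> prob_measures_gauge \<psi> \<and>
    (\<lambda>n. \<tau> (empirical_measure n \<omega>)) \<longlonglongrightarrow> \<tau> (\<upsilon> \<omega>)"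
proof -
  interpret prob_space P by fact
  have [measurable]: "(\<lambda>\<omega>. \<omega> 0) \<in> P \<rightarrow>\<^sub>M borel"
    unfolding measurable_cong_sets[OF assms(4) refl] by measurable
  have \<psi>_meas [measurable]: "\<psi> \<in> borel_measurable borel"
    using assms(1) by (rule borel_measurable_continuous_onI)
  have \<psi>_nonneg: "0 \<le> \<psi> x" for x
    using assms(2)[of x] by linarith
  have \<psi>_int: "integrable P (\<lambda>\<omega>. \<psi> (\<omega> 0))"
    using assms(7) by (intro integrableI_nonneg)
      (simp_all add: prob_measures_gauge_def nn_integral_distr \<psi>_nonneg)
  obtain H :: "('e \<Rightarrow> real) set" where H: "countable H"
    "H \<subseteq> borel_measurable borel" "\<forall>h\<in>H. \<forall>x. 0 \<le> h x" "\<forall>h\<in>H. \<exists>C. \<forall>x. h x \<le> C"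
    "\<forall>f. continuous_on UNIV f \<longrightarrow> (\<forall>x. 0 \<le> f x) \<longrightarrow>
      (\<exists>h :: nat \<Rightarrow> 'e \<Rightarrow> real. \<forall>x. (\<forall>n. h n \<in> H \<and> h n x \<le> f x) \<and> (\<lambda>n. h n x) \<longlonglongrightarrow> f x)"
    by (rule countable_class_below_continuous)
  note H_meas = subsetD[OF H(2)] and H_nonneg = H(3)[rule_format]
  have H_int: "integrable P (\<lambda>\<omega>. h (\<omega> 0))" if h: "h \<in> H" for h
  proof -
    note H_meas[OF h, measurable]
    obtain C where "\<And>x. h x \<le> C"
      using H(4) h by blast
    then show ?thesis
      by (intro integrable_const_bound[where B=C]) (auto simp: H_nonneg[OF h])
  qed
  note tendsto = integral_empirical_measure_tendsto[OF assms(3,4,6,5)]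
  \<comment> \<open>Countability of \<open>H\<close> yields one null set outside which all later
    limits are deterministic.\<close>
  have "AE \<omega> in P. \<forall>h\<in>H. (\<lambda>n. \<integral>x. h x \<partial>empirical_measure (Suc n) \<omega>) \<longlonglongrightarrow> (\<integral>x. h x \<partial>\<upsilon> \<omega>)"
    using H(1) by (subst AE_ball_countable) (auto intro!: tendsto H_int H_meas H_nonneg)
  moreover have "AE \<omega> in P. (\<lambda>n. \<integral>x. \<psi> x \<partial>empirical_measure (Suc n) \<omega>) \<longlonglongrightarrow> (\<integral>x. \<psi> x \<partial>\<upsilon> \<omega>)"
    by (rule tendsto[OF \<psi>_meas \<psi>_nonneg \<psi>_int])
  moreover have "AE \<omega> in P. integrable (\<upsilon> \<omega>) \<psi>"
    by (rule canonical_random_measure_integral(1)[OF assms(3,4,5) \<psi>_meas \<psi>_nonneg \<psi>_int])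
  ultimately have "AE \<omega> in P. \<upsilon> \<omega> \<in> prob_measures_gauge \<psi> \<and>
    (\<lambda>n. \<tau> (empirical_measure n \<omega>)) \<longlonglongrightarrow> \<tau> (\<upsilon> \<omega>)"
  proof eventually_elim
    case (elim \<omega>)
    \<comment> \<open>Being a probability measure holds for every \<open>\<omega>\<close>; only the
      integrability of \<open>\<psi>\<close> is almost sure.\<close>
    have "\<upsilon> \<omega> \<in> space (prob_algebra borel)"
      using assms(5) measurable_space[of \<upsilon> shift_invariant "prob_algebra borel" \<omega>]
      by (simp add: canonical_random_measure_def shift_invariant_def space_measure_of_conv)
    then have \<upsilon>: "\<upsilon> \<omega> \<in> prob_measures_gauge \<psi>"
      using elim(3) by (simp add: prob_measures_gauge_def integrable_iff_bounded \<psi>_nonneg)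
    note emp = empirical_measure_in_prob_measures_gauge[OF zero_less_Suc \<psi>_meas]
    have "limitin (psi_weak_topology \<psi>) (\<lambda>n. empirical_measure (Suc n) \<omega>) (\<upsilon> \<omega>) sequentially"
    proof (rule psi_weak_limitinI[OF \<upsilon> always_eventually[OF allI[OF emp]]])
      fix f assume "f \<in> gauge_continuous \<psi>"
      then show "(\<lambda>n. \<integral>x. f x \<partial>empirical_measure (Suc n) \<omega>) \<longlonglongrightarrow> (\<integral>x. f x \<partial>\<upsilon> \<omega>)"
        by (rule gauge_integral_tendsto[OF assms(1,2) \<upsilon> emp H(2,3,5) elim(1,2)])
    qed
    from continuous_map_limit[OF assms(8) this]
    have "(\<lambda>n. \<tau> (empirical_measure (Suc n) \<omega>)) \<longlonglongrightarrow> \<tau> (\<upsilon> \<omega>)"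
      by (simp add: o_def)
    \<comment> \<open>The term at 0, where \<open>\<tau>\<close> is applied to the null measure,
      does not affect the limit.\<close>
    then have "(\<lambda>n. \<tau> (empirical_measure n \<omega>)) \<longlonglongrightarrow> \<tau> (\<upsilon> \<omega>)"
      by (rule LIMSEQ_imp_Suc)
    with \<upsilon> show ?case ..
  qed
  then show ?thesis
    by (rule AE_completion)
qed

end
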